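(* For every positive integer $s$, as formal power series in $y$, \[ FC_{2}(s,y)=-\frac{y\,\frac{d}{dy}Q_s(y)}{Q_s(y)}+s+1 . \]
   Context: Definition of the counting function. The pseudo-cycle graph $C_{n,2}$ has $n$ vertices $v_1,\dots,v_n$ arranged in a cycle with $2$ self-loops at each vertex. A magic labelling with magic sum $s$ assigns a nonnegative integer to each edge (including loops) so that at each vertex the labels of incident edges (each loop counted once) sum to $s$. Explicitly, for $n\ge1$ and $s\in\mathbb{N}$, $h_{C_{n,2}}(s)$ is the number of nonnegative integer tuples $(\beta_1,\dots,\beta_n;\alpha_{i,1},\alpha_{i,2}\ (1\le i\le n))$ with $\beta_i+\alpha_{i,1}+\alpha_{i,2}+\beta_{i+1}=s$ for all $1\le i\le n$, where $\beta_{n+1}=\beta_1$ (so for $n=1$ the single condition is $2\beta_1+\alpha_{1,1}+\alpha_{1,2}=s$, and for $n=2$ there are two parallel edges between the two vertices). By convention $h_{C_{0,2}}(s)=s+1$. Set \[ FC_2(s,y)=\sum_{n=0}^{\infty}h_{C_{n,2}}(s)\,y^n . \] Definition of the polynomials. For $n\ge 4$, \[ Q_n(y)=-y[Q_{n-1}(-y)+Q_{n-3}(-y)]+2Q_{n-2}(y)-Q_{n-4}(y), \] with $Q_0(y)=1-y$, $Q_1(y)=1-2y-y^2$, $Q_2(y)=1-4y-2y^2+y^3$, $Q_3(y)=1-6y-7y^2+2y^3+y^4$. *)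

theory Defs
  imports
    "HOL-Library.FuncSet"
    "HOL-Computational_Algebra.Computational_Algebra"
begin

text \<open>
  A labelling of the pseudo-cycle graph with n vertices 1, ..., n and 2 self-loops at each vertex:
  \<open>\<beta> i\<close> is the label of the cycle edge leading to vertex i from its predecessor, and
  \<open>\<alpha> (i, j)\<close> is the label of the j-th loop at vertex i.  Extensional functions are
  used so that labellings correspond exactly to tuples.  For n = 1 the cycle edge contributes
  twice, giving \<open>2 * \<beta> 1 + \<alpha> (1, 1) + \<alpha> (1, 2) = s\<close>; for n = 2 there are two
  parallel cycle edges.  All labels are bounded by s, so the set is finite.
\<close>
definition magic_labellings_C2 ::
    "nat \<Rightarrow> nat \<Rightarrow> ((nat \<Rightarrow> nat) \<times> (nat \<times> nat \<Rightarrow> nat)) set" where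
  "magic_labellings_C2 n s =
     {(\<beta>, \<alpha>). \<beta> \<in> {1..n} \<rightarrow>\<^sub>E UNIV \<and> \<alpha> \<in> {1..n} \<times> {1, 2} \<rightarrow>\<^sub>E UNIV \<and>
        (\<forall>i\<in>{1..n}. \<beta> i + \<alpha> (i, 1) + \<alpha> (i, 2) + \<beta> (if i = n then 1 else i + 1) = s)}"

definition h_C2 :: "nat \<Rightarrow> nat \<Rightarrow> nat" where
  "h_C2 n s = (if n = 0 then s + 1 else card (magic_labellings_C2 n s))"

definition FC2 :: "nat \<Rightarrow> rat fps" where
  "FC2 s = Abs_fps (\<lambda>n. of_nat (h_C2 n s))"

definition poly_reflect :: "rat poly \<Rightarrow> rat poly" where
  \<comment> \<open>\<open>p(-y)\<close>\<close>
  "poly_reflect p = pcompose p [:0, -1:]"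

text \<open>
  Every \<open>Q n\<close> has constant coefficient 1, so it is a unit as a formal power series and
  division by it is the usual one.
\<close>
fun Q :: "nat \<Rightarrow> rat poly" where
  "Q 0 = [:1, -1:]"
| "Q (Suc 0) = [:1, -2, -1:]"
| "Q (Suc (Suc 0)) = [:1, -4, -2, 1:]"
| "Q (Suc (Suc (Suc 0))) = [:1, -6, -7, 2, 1:]"
| "Q (Suc (Suc (Suc (Suc n)))) =
     - [:0, 1:] * (poly_reflect (Q (Suc (Suc (Suc n)))) + poly_reflect (Q (Suc n)))
     + 2 * Q (Suc (Suc n)) - Q n"

end

theory Submission
  imports Defs "Jordan_Normal_Form.Determinant"
begin

text \<open>
  Summing out the loops, a labelling of the pseudo-cycle is a closed walk of length \<open>n\<close> weighted
  by the matrix \<open>M\<close> with entries \<open>max 0 (s + 1 - i - j)\<close>, \<open>0 \<le> i, j \<le> s\<close>, so the number of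
  labellings is the trace of \<open>M ^ n\<close>.  Jacobi's formula for the derivative of a determinant gives
  \<open>\<Sum>n\<ge>1. tr (M ^ n) y ^ n = - y D' / D\<close> with \<open>D = det (1 - y M)\<close>, and it remains to see \<open>D = Q s\<close>.

  Taking differences of neighbouring rows and columns turns \<open>M\<close> into the antidiagonal permutation
  matrix and the identity into a tridiagonal matrix.  In the order \<open>0, s, 1, s - 1, \<dots>\<close> of the
  indices the resulting matrix is banded, so its kernel equations, except the last two, are a linear
  recurrence that can be solved from the first two unknowns.  Replacing the first two columns by two
  such solutions makes the matrix block triangular, which reduces \<open>D\<close> to a determinant of size 2 in
  the solutions of the recurrence; that determinant satisfies the recurrence of \<open>Q\<close>.
\<close>

subsection \<open>Labellings as closed walks\<close>

lemma sum_PiE_insert: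
  fixes F :: "('a \<Rightarrow> 'b) \<Rightarrow> 'c :: comm_monoid_add"
  assumes "x \<notin> S"
  shows "sum F (PiE (insert x S) T) = (\<Sum>l\<in>T x. \<Sum>f\<in>PiE S T. F (f(x := l)))"
proof -
  have "sum F (PiE (insert x S) T) = (\<Sum>(l, f)\<in>T x \<times> PiE S T. F (f(x := l)))"
    unfolding PiE_insert_eq
    by (subst sum.reindex[OF inj_combinator[OF assms]]) (simp add: case_prod_unfold)
  then show ?thesis by (simp add: sum.cartesian_product)
qed

text \<open>Induction on \<open>n\<close>, splitting off the last vertex. The weight
  \<open>f\<close> of the two end points is kept arbitrary because the step absorbs the last factor
  of the walk into it; later it serves to close the walk.\<close>

lemma sum_walks_eq_mat_pow:
  fixes M :: "'a :: comm_semiring_1 mat"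
  assumes M: "M \<in> carrier_mat N N"
  shows "(\<Sum>\<beta>\<in>{1..Suc n} \<rightarrow>\<^sub>E {..<N}. (\<Prod>k=1..n. M $$ (\<beta> k, \<beta> (Suc k))) * f (\<beta> 1) (\<beta> (Suc n)))
    = (\<Sum>i<N. \<Sum>j<N. (M ^\<^sub>m n) $$ (i,j) * f i j)"
proof (induction n arbitrary: f)
  case 0
  have "{1..Suc 0} = insert 1 {}" by auto
  then have "(\<Sum>\<beta>\<in>{1..Suc 0} \<rightarrow>\<^sub>E {..<N}. f (\<beta> 1) (\<beta> (Suc 0))) = (\<Sum>i<N. f i i)"
    by (simp only: sum_PiE_insert empty_iff not_False_eq_True) simp
  moreover have "(\<Sum>j<N. 1\<^sub>m N $$ (i,j) * f i j) = f i i" if "i < N" for i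
  proof -
    have "(\<Sum>j<N. 1\<^sub>m N $$ (i,j) * f i j) = (\<Sum>j<N. if i = j then f i j else 0)"
      using that by (intro sum.cong) auto
    also have "\<dots> = f i i" using that by simp
    finally show ?thesis .
  qed
  ultimately show ?case using M by simp
next
  case (Suc n)
  have Mk: "M ^\<^sub>m n \<in> carrier_mat N N" using M by simp
  have ins: "{1..Suc (Suc n)} = insert (Suc (Suc n)) {1..Suc n}" by auto
  have "(\<Sum>\<beta>\<in>{1..Suc (Suc n)} \<rightarrow>\<^sub>E {..<N}.
       (\<Prod>k=1..Suc n. M $$ (\<beta> k, \<beta> (Suc k))) * f (\<beta> 1) (\<beta> (Suc (Suc n)))) =
     (\<Sum>l<N. \<Sum>\<beta>\<in>{1..Suc n} \<rightarrow>\<^sub>E {..<N}.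
       (\<Prod>k=1..n. M $$ (\<beta> k, \<beta> (Suc k))) * (M $$ (\<beta> (Suc n), l) * f (\<beta> 1) l))"
    unfolding ins by (subst sum_PiE_insert) (auto intro!: sum.cong simp: prod.nat_ivl_Suc' mult_ac)
  also have "\<dots> = (\<Sum>\<beta>\<in>{1..Suc n} \<rightarrow>\<^sub>E {..<N}.
       (\<Prod>k=1..n. M $$ (\<beta> k, \<beta> (Suc k))) * (\<Sum>l<N. M $$ (\<beta> (Suc n), l) * f (\<beta> 1) l))"
    by (subst sum.swap) (simp add: sum_distrib_left)
  also have "\<dots> = (\<Sum>i<N. \<Sum>j<N. (M ^\<^sub>m n) $$ (i,j) * (\<Sum>l<N. M $$ (j, l) * f i l))"
    by (rule Suc.IH)
  also have "\<dots> = (\<Sum>i<N. \<Sum>l<N. (M ^\<^sub>m Suc n) $$ (i,l) * f i l)"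
  proof (rule sum.cong[OF refl])
    fix i assume i: "i \<in> {..<N}"
    have "(\<Sum>j<N. (M ^\<^sub>m n) $$ (i,j) * (\<Sum>l<N. M $$ (j, l) * f i l)) =
       (\<Sum>l<N. \<Sum>j<N. (M ^\<^sub>m n) $$ (i,j) * M $$ (j,l) * f i l)"
      by (subst sum.swap) (simp add: sum_distrib_left mult_ac)
    also have "\<dots> = (\<Sum>l<N. (M ^\<^sub>m Suc n) $$ (i,l) * f i l)"
      using i M Mk by (auto intro!: sum.cong simp: scalar_prod_def atLeast0LessThan sum_distrib_right)
    finally show "(\<Sum>j<N. (M ^\<^sub>m n) $$ (i,j) * (\<Sum>l<N. M $$ (j, l) * f i l)) =
      (\<Sum>l<N. (M ^\<^sub>m Suc n) $$ (i,l) * f i l)" .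
  qed
  finally show ?case .
qed

text \<open>The label \<open>a\<close> ranges over \<open>{0..s - c - d}\<close> and determines
  \<open>b\<close>. When \<open>c + d\<close> exceeds \<open>s\<close>, the truncated subtraction
  gives the correct value 0.\<close>

lemma card_loop_labels: "card {(a :: nat, b :: nat). c + a + b + d = s} = s + 1 - c - d"
proof (cases "c + d \<le> s")
  case True
  then have "{(a, b). c + a + b + d = s} = (\<lambda>a. (a, s - c - d - a)) ` {0..s - c - d}"
    by (auto simp: image_iff)
  then show ?thesis using True by (simp add: card_image inj_on_def)
next
  case False
  then have "{(a, b). c + a + b + d = s} = {}" by auto
  then show ?thesis using False by simp
qed

definition loop_count_mat :: "nat \<Rightarrow> rat mat" where
  "loop_count_mat s = mat (s + 1) (s + 1) (\<lambda>(i,j). of_nat (s + 1 - i - j))"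

text \<open>Once \<beta> is fixed, the loop labels at different vertices are chosen independently,
  and \<open>card_loop_labels\<close> counts the choices at each vertex.\<close>

lemma card_magic_labellings_C2:
  "card (magic_labellings_C2 n s) =
    (\<Sum>\<beta>\<in>{1..n} \<rightarrow>\<^sub>E {..<s+1}. \<Prod>i=1..n. s + 1 - \<beta> i - \<beta> (if i = n then 1 else i + 1))"
proof -
  define nxt where "nxt = (\<lambda>i. if i = n then 1 else i + 1)"
  define L where "L = (\<lambda>\<beta> :: nat \<Rightarrow> nat. {\<alpha> \<in> {1..n} \<times> {1, 2 :: nat} \<rightarrow>\<^sub>E UNIV.
    \<forall>i\<in>{1..n}. \<beta> i + \<alpha> (i, 1) + \<alpha> (i, 2) + \<beta> (nxt i) = s})"
  define P where "P = (\<lambda>\<beta> i. {(a, b). \<beta> i + a + b + \<beta> (nxt i) = s})"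
  have eq: "magic_labellings_C2 n s = Sigma ({1..n} \<rightarrow>\<^sub>E {..<s+1}) L"
  proof (intro equalityI subsetI)
    fix x assume "x \<in> magic_labellings_C2 n s"
    then obtain \<beta> \<alpha> where x: "x = (\<beta>, \<alpha>)" "\<beta> \<in> {1..n} \<rightarrow>\<^sub>E UNIV" "\<alpha> \<in> L \<beta>"
      by (auto simp: magic_labellings_C2_def L_def nxt_def)
    have "\<beta> i < s + 1" if "i \<in> {1..n}" for i
    proof -
      have "\<beta> i + \<alpha> (i, 1) + \<alpha> (i, 2) + \<beta> (nxt i) = s" using x that unfolding L_def by blast
      then show ?thesis by linarith
    qed
    then show "x \<in> Sigma ({1..n} \<rightarrow>\<^sub>E {..<s+1}) L" using x by (auto simp: PiE_iff)
  qed (auto simp: magic_labellings_C2_def L_def nxt_def PiE_iff)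
  \<comment> \<open>Currying: a labelling of all loops is the same as a choice of a pair of labels
    at each vertex.\<close>
  have L: "bij_betw (\<lambda>\<alpha>. restrict (\<lambda>i. (\<alpha> (i, 1), \<alpha> (i, 2))) {1..n}) (L \<beta>) (PiE {1..n} (P \<beta>))" for \<beta>
  proof (rule bij_betw_byWitness[where
        f' = "\<lambda>g. restrict (\<lambda>(i, j). if j = 1 then fst (g i) else snd (g i)) ({1..n} \<times> {1, 2 :: nat})"])
    show "\<forall>\<alpha>\<in>L \<beta>. restrict (\<lambda>(i, j). if j = 1
        then fst (restrict (\<lambda>i. (\<alpha> (i, 1), \<alpha> (i, 2))) {1..n} i)
        else snd (restrict (\<lambda>i. (\<alpha> (i, 1), \<alpha> (i, 2))) {1..n} i)) ({1..n} \<times> {1, 2 :: nat}) = \<alpha>"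
    proof
      fix \<alpha> assume "\<alpha> \<in> L \<beta>"
      then have ext: "\<alpha> \<in> extensional ({1..n} \<times> {1, 2 :: nat})" by (auto simp: L_def PiE_iff)
      show "restrict (\<lambda>(i, j). if j = 1
        then fst (restrict (\<lambda>i. (\<alpha> (i, 1), \<alpha> (i, 2))) {1..n} i)
        else snd (restrict (\<lambda>i. (\<alpha> (i, 1), \<alpha> (i, 2))) {1..n} i)) ({1..n} \<times> {1, 2 :: nat}) = \<alpha>"
        by (rule extensionalityI[OF restrict_extensional ext]) auto
    qed
    show "\<forall>g\<in>PiE {1..n} (P \<beta>). restrict (\<lambda>i.
        (restrict (\<lambda>(i, j). if j = 1 then fst (g i) else snd (g i)) ({1..n} \<times> {1, 2 :: nat}) (i, 1),
         restrict (\<lambda>(i, j). if j = 1 then fst (g i) else snd (g i)) ({1..n} \<times> {1, 2 :: nat}) (i, 2))) {1..n} = g"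
    proof
      fix g assume "g \<in> PiE {1..n} (P \<beta>)"
      then have ext: "g \<in> extensional {1..n}" by (auto simp: PiE_iff)
      show "restrict (\<lambda>i.
        (restrict (\<lambda>(i, j). if j = 1 then fst (g i) else snd (g i)) ({1..n} \<times> {1, 2 :: nat}) (i, 1),
         restrict (\<lambda>(i, j). if j = 1 then fst (g i) else snd (g i)) ({1..n} \<times> {1, 2 :: nat}) (i, 2))) {1..n} = g"
        by (rule extensionalityI[OF restrict_extensional ext]) auto
    qed
  qed (auto simp: L_def P_def PiE_iff case_prod_unfold)
  have card_L: "card (L \<beta>) = (\<Prod>i=1..n. s + 1 - \<beta> i - \<beta> (nxt i))" for \<beta>
    by (simp add: bij_betw_same_card[OF L] card_PiE P_def card_loop_labels)
  have "finite (P \<beta> i)" for \<beta> i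
    by (rule finite_subset[of _ "{..s} \<times> {..s}"]) (auto simp: P_def)
  then have "finite (L \<beta>)" for \<beta>
    using bij_betw_finite[OF L, of \<beta>] by (simp add: finite_PiE)
  then show ?thesis
    unfolding eq by (subst card_SigmaI) (auto simp: card_L nxt_def finite_PiE)
qed

text \<open>A walk of \<open>n - 1\<close> steps from i to j is closed by the end point weight
  \<open>M $$ (j,i)\<close>. For \<open>n = 1\<close> the walk is a single vertex and the weight is
  a diagonal entry, in accordance with the cycle edge that counts twice.\<close>

lemma h_C2_eq_trace:
  assumes "n > 0"
  shows "of_nat (h_C2 n s) = (\<Sum>i<s+1. (loop_count_mat s ^\<^sub>m n) $$ (i,i))"
proof -
  define N where "N = s + 1"
  define M where "M = loop_count_mat s"
  have M: "M \<in> carrier_mat N N" by (simp add: M_def loop_count_mat_def N_def)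
  obtain m where n: "n = Suc m" using assms gr0_implies_Suc by blast
  have Mk: "M ^\<^sub>m m \<in> carrier_mat N N" using M by simp
  have "of_nat (h_C2 n s) = (\<Sum>\<beta>\<in>{1..Suc m} \<rightarrow>\<^sub>E {..<N}.
      (\<Prod>k=1..m. M $$ (\<beta> k, \<beta> (Suc k))) * M $$ (\<beta> (Suc m), \<beta> 1))"
  proof -
    have "(\<Prod>i=1..n. of_nat (s + 1 - \<beta> i - \<beta> (if i = n then 1 else i + 1))) =
      (\<Prod>k=1..m. M $$ (\<beta> k, \<beta> (Suc k))) * M $$ (\<beta> (Suc m), \<beta> 1)"
      if \<beta>: "\<beta> \<in> {1..Suc m} \<rightarrow>\<^sub>E {..<N}" for \<beta>
    proof -
      have b: "\<beta> i < s + 1" if "1 \<le> i" "i \<le> Suc m" for i using \<beta> that by (auto simp: PiE_iff N_def)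
      have "(\<Prod>k=1..m. of_nat (s + 1 - \<beta> k - \<beta> (if k = n then 1 else k + 1))) =
        (\<Prod>k=1..m. M $$ (\<beta> k, \<beta> (Suc k)))"
        using b by (intro prod.cong) (auto simp: n M_def loop_count_mat_def)
      moreover have "of_nat (s + 1 - \<beta> (Suc m) - \<beta> 1) = M $$ (\<beta> (Suc m), \<beta> 1)"
        using b[of 1] b[of "Suc m"] by (simp add: M_def loop_count_mat_def)
      ultimately show ?thesis by (simp add: n prod.nat_ivl_Suc')
    qed
    then show ?thesis
      using assms by (simp add: h_C2_def card_magic_labellings_C2 N_def n cong: sum.cong)
  qed
  also have "\<dots> = (\<Sum>i<N. \<Sum>j<N. (M ^\<^sub>m m) $$ (i,j) * M $$ (j,i))"
    by (rule sum_walks_eq_mat_pow[OF M])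
  also have "\<dots> = (\<Sum>i<N. (M ^\<^sub>m n) $$ (i,i))"
    using M Mk by (auto intro!: sum.cong simp: n scalar_prod_def atLeast0LessThan)
  finally show ?thesis by (simp add: M_def N_def)
qed

subsection \<open>The logarithmic derivative of the reversed characteristic polynomial\<close>

lemma fps_deriv_prod_sum:
  fixes f :: "'i \<Rightarrow> 'a :: comm_ring_1 fps"
  assumes "finite S"
  shows "fps_deriv (prod f S) = (\<Sum>i\<in>S. fps_deriv (f i) * prod f (S - {i}))"
  using assms
proof (induction S rule: finite_induct)
  case (insert x S)
  have "prod f (insert x S - {i}) = f x * prod f (S - {i})" if "i \<in> S" for i
  proof -
    have "insert x S - {i} = insert x (S - {i})" using insert that by auto
    then show ?thesis using insert by simp
  qed
  moreover have "insert x S - {x} = S" using insert by auto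
  ultimately show ?case
    using insert by (simp add: sum_distrib_left mult_ac cong: sum.cong)
qed simp

text \<open>Jacobi's formula. The product rule in the Leibniz expansion gives the sum over
  \<open>i\<close> of the determinants with row \<open>i\<close> differentiated
  (\<open>B i\<close>); expansion along that row involves only cofactors of
  \<open>A\<close>.\<close>

lemma fps_deriv_det:
  fixes A :: "'a :: comm_ring_1 fps mat"
  assumes A: "A \<in> carrier_mat n n"
  shows "fps_deriv (det A) = (\<Sum>i<n. \<Sum>j<n. fps_deriv (A $$ (i,j)) * cofactor A i j)"
proof -
  define B where "B = (\<lambda>i. mat n n (\<lambda>(k,l). if k = i then fps_deriv (A $$ (k,l)) else A $$ (k,l)))"
  have B: "B i \<in> carrier_mat n n" for i by (simp add: B_def)
  have row: "(\<Prod>k = 0..<n. B i $$ (k, p k)) =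
      fps_deriv (A $$ (i, p i)) * (\<Prod>k\<in>{0..<n} - {i}. A $$ (k, p k))"
    if p: "p permutes {0..<n}" and i: "i \<in> {0..<n}" for i p
  proof -
    have pk: "p k < n" if "k < n" for k using permutes_in_image[OF p, of k] that by auto
    have "(\<Prod>k = 0..<n. B i $$ (k, p k)) = B i $$ (i, p i) * (\<Prod>k\<in>{0..<n} - {i}. B i $$ (k, p k))"
      using i by (simp add: prod.remove)
    also have "(\<Prod>k\<in>{0..<n} - {i}. B i $$ (k, p k)) = (\<Prod>k\<in>{0..<n} - {i}. A $$ (k, p k))"
      by (rule prod.cong) (auto simp: B_def pk)
    finally show ?thesis using i pk[of i] by (simp add: B_def)
  qed
  have sgn: "fps_deriv (signof p * f) = signof p * fps_deriv f"
    for p :: "nat \<Rightarrow> nat" and f :: "'a fps"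
    using signof_pm_one[of p, where 'a = "'a fps"] by auto
  have "fps_deriv (det A) = (\<Sum>p | p permutes {0..<n}. \<Sum>i=0..<n. signof p * (\<Prod>k = 0..<n. B i $$ (k, p k)))"
    by (auto simp: det_def'[OF A] fps_deriv_sum sgn fps_deriv_prod_sum sum_distrib_left row
        intro!: sum.cong)
  also have "\<dots> = (\<Sum>i=0..<n. det (B i))"
    by (subst sum.swap) (simp add: det_def'[OF B])
  also have "\<dots> = (\<Sum>i<n. \<Sum>j<n. fps_deriv (A $$ (i,j)) * cofactor A i j)"
    unfolding atLeast0LessThan
  proof (rule sum.cong[OF refl])
    fix i assume i: "i \<in> {..<n}"
    have "mat_delete (B i) i j = mat_delete A i j" if "j < n" for j
      by (rule eq_matI) (use A i that in \<open>auto simp: mat_delete_def B_def\<close>)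
    then show "det (B i) = (\<Sum>j<n. fps_deriv (A $$ (i,j)) * cofactor A i j)"
      using i by (subst laplace_expansion_row[OF B, of i])
        (auto simp: cofactor_def B_def intro!: sum.cong)
  qed
  finally show ?thesis .
qed

text \<open>The matrix 1 - y M. Its entries are power series so that its inverse is the Neumann
  series of the powers of M.\<close>

definition char_rev_mat :: "'a :: comm_ring_1 mat \<Rightarrow> 'a fps mat" where
  "char_rev_mat M = mat (dim_row M) (dim_row M)
     (\<lambda>(i,j). of_bool (i = j) - fps_X * fps_const (M $$ (i,j)))"

text \<open>The Neumann series \<open>S\<close> is a right inverse of \<open>A\<close>, so the
  adjugate of \<open>A\<close> is \<open>det A\<close> times \<open>S\<close>, and Jacobi's formula
  turns into a trace of M times \<open>S\<close>.\<close>

lemma fps_deriv_char_rev: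
  fixes M :: "'a :: comm_ring_1 mat"
  assumes M: "M \<in> carrier_mat n n"
  shows "fps_X * fps_deriv (det (char_rev_mat M)) =
    - det (char_rev_mat M) * Abs_fps (\<lambda>k. if k = 0 then 0 else \<Sum>i<n. (M ^\<^sub>m k) $$ (i,i))"
proof -
  define A where "A = char_rev_mat M"
  define S where "S = mat n n (\<lambda>(i,j). Abs_fps (\<lambda>k. (M ^\<^sub>m k) $$ (i,j)))"
  have A: "A \<in> carrier_mat n n" using M by (simp add: A_def char_rev_mat_def)
  have S: "S \<in> carrier_mat n n" by (simp add: S_def)
  have Mk: "M ^\<^sub>m k \<in> carrier_mat n n" for k using M by simp
  \<comment> \<open>\<open>pow_mat\<close> puts the new factor on the right, while the product
    \<open>A * S\<close> produces it on the left.\<close>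
  have pow_Suc: "(M ^\<^sub>m Suc k) $$ (i,j) = (\<Sum>l<n. M $$ (i,l) * (M ^\<^sub>m k) $$ (l,j))"
    if "i < n" "j < n" for i j k
  proof -
    have "M ^\<^sub>m Suc k = M * M ^\<^sub>m k"
      by (induction k) (use M Mk in \<open>auto simp: assoc_mult_mat[OF M Mk M]\<close>)
    then show ?thesis using M Mk[of k] that
      by (simp add: scalar_prod_def atLeast0LessThan)
  qed
  have "A * S = 1\<^sub>m n"
  proof (rule eq_matI)
    fix i j assume "i < dim_row (1\<^sub>m n)" "j < dim_col (1\<^sub>m n :: 'a fps mat)"
    then have ij: "i < n" "j < n" by auto
    have "(A * S) $$ (i,j) = (\<Sum>l<n. (of_bool (i = l) - fps_X * fps_const (M $$ (i,l))) * S $$ (l,j))"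
      using A S M ij by (simp add: scalar_prod_def atLeast0LessThan A_def char_rev_mat_def)
    also have "\<dots> = S $$ (i,j) - fps_X * (\<Sum>l<n. fps_const (M $$ (i,l)) * S $$ (l,j))"
      using ij by (simp add: left_diff_distrib sum_subtractf sum_distrib_left mult.assoc
          of_bool_def if_distrib[of "\<lambda>x. x * _"] sum.delta cong: if_cong)
    also have "\<dots> = 1\<^sub>m n $$ (i,j)"
    proof (rule fps_ext)
      fix k
      show "(S $$ (i,j) - fps_X * (\<Sum>l<n. fps_const (M $$ (i,l)) * S $$ (l,j))) $ k
          = (1\<^sub>m n $$ (i,j) :: 'a fps) $ k"
      proof (cases k)
        case 0
        then show ?thesis using ij M by (simp add: S_def)
      next
        case (Suc k')
        then show ?thesis using ij M Suc pow_Suc[of i j k']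
          by (simp add: S_def fps_sum_nth del: pow_mat.simps)
      qed
    qed
    finally show "(A * S) $$ (i,j) = 1\<^sub>m n $$ (i,j)" .
  qed (use A S in auto)
  then have "adj_mat A = adj_mat A * (A * S)"
    using adj_mat(1)[OF A] by simp
  also have "\<dots> = det A \<cdot>\<^sub>m S"
    using adj_mat[OF A] A S by (simp add: mult_smult_assoc_mat[OF one_carrier_mat S] flip: assoc_mult_mat)
  finally have adj: "adj_mat A = det A \<cdot>\<^sub>m S" .
  have cof: "cofactor A i j = det A * S $$ (j,i)" if "i < n" "j < n" for i j
  proof -
    have "cofactor A i j = adj_mat A $$ (j,i)" using that A by (simp add: adj_mat_def)
    then show ?thesis unfolding adj using that S by simp
  qed
  have "fps_deriv (A $$ (i,j)) = - fps_const (M $$ (i,j))" if "i < n" "j < n" for i j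
    using that M by (simp add: A_def char_rev_mat_def of_bool_def)
  then have "fps_deriv (det A) = (\<Sum>i<n. \<Sum>j<n. - fps_const (M $$ (i,j)) * (det A * S $$ (j,i)))"
    by (simp add: fps_deriv_det[OF A] cof)
  also have "\<dots> = - det A * (\<Sum>i<n. \<Sum>j<n. fps_const (M $$ (i,j)) * S $$ (j,i))"
    by (simp add: sum_distrib_left sum_negf mult_ac del: fps_const_neg)
  also have "(\<Sum>i<n. \<Sum>j<n. fps_const (M $$ (i,j)) * S $$ (j,i)) =
      Abs_fps (\<lambda>k. \<Sum>i<n. (M ^\<^sub>m Suc k) $$ (i,i))"
    by (rule fps_ext) (simp add: fps_sum_nth pow_Suc S_def del: pow_mat.simps)
  finally have "fps_X * fps_deriv (det A) =
      - det A * (fps_X * Abs_fps (\<lambda>k. \<Sum>i<n. (M ^\<^sub>m Suc k) $$ (i,i)))"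
    by (simp add: mult_ac)
  also have "fps_X * Abs_fps (\<lambda>k. \<Sum>i<n. (M ^\<^sub>m Suc k) $$ (i,i)) =
      Abs_fps (\<lambda>k. if k = 0 then 0 else \<Sum>i<n. (M ^\<^sub>m k) $$ (i,i))"
    by (rule fps_ext) (simp del: pow_mat.simps)
  finally show ?thesis unfolding A_def .
qed

subsection \<open>The polynomials \<open>Q\<close> as determinants of size 2\<close>

text \<open>Chebyshev polynomials of the second kind in disguise: the sum and the difference of
  \<open>zigzag_a j\<close> and \<open>zigzag_b j\<close> are U_(j-1) at 1 - y/2 and at 1 + y/2,
  respectively.\<close>

fun zigzag_a :: "nat \<Rightarrow> rat poly" and zigzag_b :: "nat \<Rightarrow> rat poly" where
  "zigzag_a 0 = 0"
| "zigzag_a (Suc 0) = 1"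
| "zigzag_a (Suc (Suc j)) = 2 * zigzag_a (Suc j) - [:0, 1:] * zigzag_b (Suc j) - zigzag_a j"
| "zigzag_b 0 = 0"
| "zigzag_b (Suc 0) = 0"
| "zigzag_b (Suc (Suc j)) = 2 * zigzag_b (Suc j) - [:0, 1:] * zigzag_a (Suc j) - zigzag_b j"

lemma poly_reflect_add: "poly_reflect (p + q) = poly_reflect p + poly_reflect q"
  and poly_reflect_diff: "poly_reflect (p - q) = poly_reflect p - poly_reflect q"
  and poly_reflect_mult: "poly_reflect (p * q) = poly_reflect p * poly_reflect q"
  and poly_reflect_uminus: "poly_reflect (- p) = - poly_reflect p"
  and poly_reflect_0: "poly_reflect 0 = 0"
  and poly_reflect_1: "poly_reflect 1 = 1"
  and poly_reflect_2: "poly_reflect 2 = 2"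
  and poly_reflect_X: "poly_reflect [:0, 1:] = - [:0, 1:]"
  by (simp_all add: poly_reflect_def pcompose_add pcompose_diff pcompose_mult pcompose_uminus
      pcompose_pCons numeral_poly one_pCons)

lemmas poly_reflect_simps = poly_reflect_add poly_reflect_diff poly_reflect_mult
  poly_reflect_uminus poly_reflect_0 poly_reflect_1 poly_reflect_2 poly_reflect_X

text \<open>\<open>zigzag_a\<close> is even and \<open>zigzag_b\<close> is odd in y, since the
  recurrences couple the two only through a factor y. This removes the reflections from the
  recurrence of \<open>Q\<close>.\<close>

lemma poly_reflect_zigzag:
  "poly_reflect (zigzag_a j) = zigzag_a j \<and> poly_reflect (zigzag_b j) = - zigzag_b j"
proof (induction j rule: less_induct)
  case (less j)
  show ?case
  proof (cases "j < 2")
    case True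
    then have "j = 0 \<or> j = 1" by auto
    then show ?thesis by (auto simp: poly_reflect_simps)
  next
    case False
    then obtain i where "j = Suc (Suc i)"
      by (metis Suc_le_D not_less_eq_eq numeral_2_eq_2 linorder_not_le)
    with less[of i] less[of "Suc i"]
    have ih: "poly_reflect (zigzag_a i) = zigzag_a i" "poly_reflect (zigzag_b i) = - zigzag_b i"
      "poly_reflect (zigzag_a (Suc i)) = zigzag_a (Suc i)"
      "poly_reflect (zigzag_b (Suc i)) = - zigzag_b (Suc i)"
      by auto
    have "poly_reflect (zigzag_a j) = zigzag_a j" "poly_reflect (zigzag_b j) = - zigzag_b j"
      unfolding \<open>j = Suc (Suc i)\<close> zigzag_a.simps zigzag_b.simps poly_reflect_simps ih
      by Groebner_Basis.algebra+
    then show ?thesis by blast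
  qed
qed

text \<open>
  The determinants left over by the last two kernel equations, for the index \<open>s = 2 * m - 1\<close> in the
  first case and \<open>s = 2 * m\<close> in the second; \<open>bdry_even\<close> is meant for \<open>m > 0\<close> only.
\<close>

definition bdry_even :: "nat \<Rightarrow> rat poly" where
  "bdry_even m = (let a = zigzag_a; b = zigzag_b in
     (a (Suc m) - b m) * (a (Suc m) - a m - b m + b (m - 1))
     - (b (Suc m) - b m - a m + a (m - 1)) * (b (Suc m) - a m))"

definition bdry_odd :: "nat \<Rightarrow> rat poly" where
  "bdry_odd m = (let a = zigzag_a; b = zigzag_b in
     (a (Suc m) - a m - b (Suc m) + b m) * (a (m+2) + b (m+2) + ([:0, 1:] - 2) * b (Suc m))
     - (b (Suc m) - a (Suc m)) * (b (m+2) - b (Suc m) + (a (m+2) - a (Suc m))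
         + ([:0, 1:] - 2) * (a (Suc m) - a m)))"

text \<open>The recurrence of \<open>Q\<close> has order four, so the step goes back to
  \<open>m - 1\<close> and \<open>m - 2\<close>, and the cases 0 and 1 are computed. By parity a
  reflection only changes the signs of y and of the \<open>zigzag_b\<close> terms.\<close>

lemma Q_eq_bdry: "Q (2 * m) = bdry_odd m \<and> Q (2 * m + 1) = bdry_even (Suc m)"
proof (induction m rule: less_induct)
  case (less m)
  consider "m = 0" | "m = 1" | k where "m = Suc (Suc k)"
    by (metis One_nat_def not0_implies_Suc)
  then show ?case
  proof cases
    case 1
    then show ?thesis
      by (simp add: bdry_even_def bdry_odd_def numeral_2_eq_2 numeral_poly one_pCons)
  next
    case 2
    then have "2 * m = Suc (Suc 0)" "2 * m + 1 = Suc (Suc (Suc 0))" by auto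
    then show ?thesis
      unfolding 2 by (simp add: bdry_even_def bdry_odd_def numeral_2_eq_2 numeral_poly one_pCons)
  next
    case 3
    \<comment> \<open>With the values at \<open>k\<close> and \<open>Suc k\<close> treated as
      indeterminates, both claims are identities that follow from the zigzag recurrences
      alone.\<close>
    define y where "y = [:0, 1 :: rat:]"
    define a0 where "a0 = zigzag_a k"
    define a1 where "a1 = zigzag_a (Suc k)"
    define b0 where "b0 = zigzag_b k"
    define b1 where "b1 = zigzag_b (Suc k)"
    define a2 where "a2 = 2 * a1 - y * b1 - a0"
    define b2 where "b2 = 2 * b1 - y * a1 - b0"
    define a3 where "a3 = 2 * a2 - y * b2 - a1"
    define b3 where "b3 = 2 * b2 - y * a2 - b1"
    define a4 where "a4 = 2 * a3 - y * b3 - a2"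
    define b4 where "b4 = 2 * b3 - y * a3 - b2"
    have a: "zigzag_a (Suc (Suc k)) = a2" "zigzag_a (Suc (Suc (Suc k))) = a3"
        "zigzag_a (Suc (Suc (Suc (Suc k)))) = a4"
      and b: "zigzag_b (Suc (Suc k)) = b2" "zigzag_b (Suc (Suc (Suc k))) = b3"
        "zigzag_b (Suc (Suc (Suc (Suc k)))) = b4"
      by (simp_all only: zigzag_a.simps zigzag_b.simps y_def a0_def a1_def b0_def b1_def
          a2_def a3_def a4_def b2_def b3_def b4_def)
    note ab = a b a0_def[symmetric] b0_def[symmetric] a1_def[symmetric] b1_def[symmetric]
    have reflect_ab: "poly_reflect a0 = a0" "poly_reflect a1 = a1" "poly_reflect a2 = a2" "poly_reflect a3 = a3"
       "poly_reflect a4 = a4"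
       "poly_reflect b0 = - b0" "poly_reflect b1 = - b1" "poly_reflect b2 = - b2" "poly_reflect b3 = - b3"
       "poly_reflect b4 = - b4" "poly_reflect y = - y"
      using poly_reflect_zigzag[of k] poly_reflect_zigzag[of "Suc k"]
        poly_reflect_zigzag[of "Suc (Suc k)"] poly_reflect_zigzag[of "Suc (Suc (Suc k))"]
        poly_reflect_zigzag[of "Suc (Suc (Suc (Suc k)))"]
      unfolding ab by (auto simp: y_def poly_reflect_X)
    have dbl: "2 * m = Suc (Suc (Suc (Suc (2 * k))))" "2 * m + 1 = Suc (Suc (Suc (Suc (Suc (2 * k)))))"
      using 3 by auto
    have IH: "Q (2 * k) = bdry_odd k" "Q (Suc (2 * k)) = bdry_even (Suc k)"
      "Q (Suc (Suc (2 * k))) = bdry_odd (Suc k)" "Q (Suc (Suc (Suc (2 * k)))) = bdry_even (Suc (Suc k))"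
      using less[of k] less[of "Suc k"] 3 by auto
    have E: "bdry_odd k = (a1 - a0 - b1 + b0) * (a2 + b2 + (y - 2) * b1) - (b1 - a1) * (b2 - b1 + (a2 - a1) + (y - 2) * (a1 - a0))"
      "bdry_even (Suc k) = (a2 - b1) * (a2 - a1 - b1 + b0) - (b2 - b1 - a1 + a0) * (b2 - a1)"
      "bdry_odd (Suc k) = (a2 - a1 - b2 + b1) * (a3 + b3 + (y - 2) * b2) - (b2 - a2) * (b3 - b2 + (a3 - a2) + (y - 2) * (a2 - a1))"
      "bdry_even (Suc (Suc k)) = (a3 - b2) * (a3 - a2 - b2 + b1) - (b3 - b2 - a2 + a1) * (b3 - a2)"
      "bdry_odd (Suc (Suc k)) = (a3 - a2 - b3 + b2) * (a4 + b4 + (y - 2) * b3) - (b3 - a3) * (b4 - b3 + (a4 - a3) + (y - 2) * (a3 - a2))"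
      "bdry_even (Suc (Suc (Suc k))) = (a4 - b3) * (a4 - a3 - b3 + b2) - (b4 - b3 - a3 + a2) * (b4 - a3)"
      unfolding bdry_even_def bdry_odd_def Let_def add_2_eq_Suc' diff_Suc_1 ab y_def[symmetric]
      by (rule refl)+
    have R: "Q (Suc (Suc (Suc (Suc i)))) = - y * (poly_reflect (Q (Suc (Suc (Suc i)))) + poly_reflect (Q (Suc i)))
      + 2 * Q (Suc (Suc i)) - Q i" for i
      unfolding y_def by simp
    have even: "Q (2 * m) = bdry_odd m"
      unfolding dbl R IH unfolding 3 unfolding E poly_reflect_simps reflect_ab
      using a2_def b2_def a3_def b3_def a4_def b4_def by Groebner_Basis.algebra
    \<comment> \<open>The recurrence for the odd index refers to \<open>Q (2 * m)\<close>, which has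
      just been determined.\<close>
    have "Q (2 * m + 1) = bdry_even (Suc m)"
      unfolding dbl(2) R[of "Suc (2*k)"] IH even[unfolded dbl(1)] unfolding 3 unfolding E poly_reflect_simps reflect_ab
      using a2_def b2_def a3_def b3_def a4_def b4_def by Groebner_Basis.algebra
    with even show ?thesis by blast
  qed
qed

subsection \<open>Evaluation of the determinant\<close>

text \<open>The sign of \<open>p\<close> enters twice, once for the rows and once, after
  transposition, for the columns.\<close>

lemma det_permute_rows_cols:
  fixes A :: "'a :: comm_ring_1 mat"
  assumes A: "A \<in> carrier_mat n n" and p: "p permutes {0..<n}"
  shows "det (mat n n (\<lambda>(i,j). A $$ (p i, p j))) = det A"
proof -
  define B where "B = mat n n (\<lambda>(i,j). A $$ (p i, j))"
  have B: "B \<in> carrier_mat n n" by (simp add: B_def)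
  have pk: "p k < n" if "k < n" for k using permutes_in_image[OF p, of k] that by auto
  have "det (mat n n (\<lambda>(i,j). A $$ (p i, p j))) =
      det (mat n n (\<lambda>(i,j). transpose_mat B $$ (p i, j)))"
    by (subst det_transpose[symmetric, of _ n])
      (auto intro!: arg_cong[of _ _ det] eq_matI simp: B_def pk)
  also have "\<dots> = signof p * det B"
    using det_permute_rows[OF _ p, of "transpose_mat B"] B by (simp add: det_transpose)
  also have "det B = signof p * det A"
    unfolding B_def by (rule det_permute_rows[OF A p])
  also have "signof p * (signof p * det A) = det A"
    using signof_pm_one[of p, where 'a = 'a] by auto
  finally show ?thesis .
qed

lemma det_mat_2: "det (mat 2 2 f) = f (0,0) * f (1,1) - f (0,1) * f (1,0)"
  for f :: "nat \<times> nat \<Rightarrow> 'a :: comm_ring_1"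
proof -
  have "det (mat 2 2 f) = (\<Sum>i<2. mat 2 2 f $$ (i,0) * cofactor (mat 2 2 f) i 0)"
    by (rule laplace_expansion_column) auto
  also have "\<dots> = f (0,0) * f (1,1) - f (0,1) * f (1,0)"
    by (simp add: lessThan_Suc numeral_2_eq_2 cofactor_def mat_delete_def det_single)
  finally show ?thesis .
qed

section \<open>Differences of neighbouring rows and columns\<close>

definition diff_mat :: "nat \<Rightarrow> 'a :: comm_ring_1 mat" where
  "diff_mat n = mat n n (\<lambda>(i,j). of_bool (i = j) - of_bool (j = Suc i))"

lemma diff_mat_carrier [simp]: "diff_mat n \<in> carrier_mat n n"
  by (simp add: diff_mat_def)

lemma det_diff_mat: "det (diff_mat n :: 'a :: comm_ring_1 mat) = 1"
proof -
  have "diag_mat (diff_mat n :: 'a mat) = replicate n 1"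
    by (rule nth_equalityI) (auto simp: diff_mat_def diag_mat_def)
  then show ?thesis
    by (subst det_upper_triangular[of _ n]) (auto simp: diff_mat_def upper_triangular_def)
qed

lemma diff_mat_mult:
  assumes "A \<in> carrier_mat n n" "i < n" "j < n"
  shows "(diff_mat n * A) $$ (i,j) = A $$ (i,j) - (if Suc i < n then A $$ (Suc i, j) else 0)"
proof -
  have "(diff_mat n * A) $$ (i,j) = (\<Sum>k<n. (of_bool (i = k) - of_bool (k = Suc i)) * A $$ (k,j))"
    using assms by (simp add: diff_mat_def scalar_prod_def atLeast0LessThan)
  also have "\<dots> = (\<Sum>k<n. (if i = k then A $$ (k,j) else 0) - (if k = Suc i then A $$ (k,j) else 0))"
    by (rule sum.cong) auto
  finally show ?thesis using assms by (simp add: sum_subtractf)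
qed

lemma mult_diff_mat_transpose:
  assumes "A \<in> carrier_mat n n" "i < n" "j < n"
  shows "(A * transpose_mat (diff_mat n)) $$ (i,j) =
    A $$ (i,j) - (if Suc j < n then A $$ (i, Suc j) else 0)"
proof -
  have "(A * transpose_mat (diff_mat n)) $$ (i,j) =
      (\<Sum>k<n. A $$ (i,k) * (of_bool (j = k) - of_bool (k = Suc j)))"
    using assms by (simp add: diff_mat_def scalar_prod_def atLeast0LessThan)
  also have "\<dots> = (\<Sum>k<n. (if j = k then A $$ (i,k) else 0) - (if k = Suc j then A $$ (i,k) else 0))"
    by (rule sum.cong) auto
  finally show ?thesis using assms by (simp add: sum_subtractf)
qed

text \<open>The polynomial form of 1 - y M, to which the row and column operations are applied;
  \<open>fps_of_poly\<close> carries it to \<open>char_rev_mat (loop_count_mat s)\<close>.\<close>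

definition char_rev_poly_mat :: "nat \<Rightarrow> rat poly mat" where
  "char_rev_poly_mat s = mat (Suc s) (Suc s)
     (\<lambda>(i,j). of_bool (i = j) - [:0, 1:] * of_nat (Suc s - i - j))"

text \<open>A negated second difference minus y times the reflection of the indices. The end
  conditions on a vector f are f(-1) = 0 and f(s+1) = f(s); the latter makes the last diagonal entry
  of the tridiagonal part 1 instead of 2.\<close>

definition cross_mat :: "nat \<Rightarrow> rat poly mat" where
  "cross_mat s = mat (Suc s) (Suc s)
     (\<lambda>(i,j). 2 * of_bool (j = i) - of_bool (i = Suc j) - of_bool (j = (if i = s then s else Suc i))
        - [:0, 1:] * of_bool (j = s - i))"

lemma cross_mat_carrier [simp]: "cross_mat s \<in> carrier_mat (Suc s) (Suc s)"
  by (simp add: cross_mat_def)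

text \<open>Row differences of \<open>Suc s - i - j\<close> give the indicator of
  \<open>i + j \<le> s\<close>, and column differences of that give the indicator of
  \<open>i + j = s\<close>. A further row or column would be zero in this part, so only the identity
  part has an exceptional corner.\<close>

lemma cross_mat_eq: "cross_mat s = diff_mat (Suc s) * char_rev_poly_mat s * transpose_mat (diff_mat (Suc s))"
proof (rule eq_matI)
  let ?n = "Suc s"
  let ?E = "char_rev_poly_mat s"
  have E: "?E \<in> carrier_mat ?n ?n" by (simp add: char_rev_poly_mat_def)
  have GE: "diff_mat ?n * ?E \<in> carrier_mat ?n ?n" using E by (simp add: mult_carrier_mat[of _ _ ?n])
  fix i j assume "i < dim_row (diff_mat ?n * ?E * transpose_mat (diff_mat ?n))"
    "j < dim_col (diff_mat ?n * ?E * transpose_mat (diff_mat ?n))"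
  then have ij: "i < ?n" "j < ?n" by (auto simp: diff_mat_def)
  have step: "(of_nat (Suc s - i - j) :: rat poly) = of_nat (Suc s - Suc i - j) + of_bool (i + j \<le> s)" for i j
  proof -
    have "Suc s - i - j = Suc s - Suc i - j + of_bool (i + j \<le> s)" by auto
    then show ?thesis by (metis of_nat_add of_nat_of_bool)
  qed
  have GE_entry: "(diff_mat ?n * ?E) $$ (i,j) =
      of_bool (i = j) - of_bool (j = Suc i) - [:0, 1:] * of_bool (i + j \<le> s)"
    if "i < ?n" "j < ?n" for i j
    using that step[of i j] by (subst diff_mat_mult[OF E that])
      (auto simp: char_rev_poly_mat_def algebra_simps simp del: mult_pCons_left)
  have "(diff_mat ?n * ?E * transpose_mat (diff_mat ?n)) $$ (i,j) =
      of_bool (i = j) - of_bool (j = Suc i) - [:0, 1:] * of_bool (i + j \<le> s)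
      - (if Suc j < ?n then of_bool (i = Suc j) - of_bool (Suc j = Suc i)
          - [:0, 1:] * of_bool (i + Suc j \<le> s) else 0)"
    using ij by (simp add: mult_diff_mat_transpose[OF GE] GE_entry del: mult_pCons_left)
  then show "cross_mat s $$ (i,j) = (diff_mat ?n * ?E * transpose_mat (diff_mat ?n)) $$ (i,j)"
    using ij by (auto simp: cross_mat_def simp del: mult_pCons_left)
qed (auto simp: cross_mat_def diff_mat_def)

lemma det_cross_mat: "det (cross_mat s) = det (char_rev_poly_mat s)"
proof -
  have E: "char_rev_poly_mat s \<in> carrier_mat (Suc s) (Suc s)" by (simp add: char_rev_poly_mat_def)
  then have GE: "diff_mat (Suc s) * char_rev_poly_mat s \<in> carrier_mat (Suc s) (Suc s)"
    by (simp add: mult_carrier_mat[of _ _ "Suc s"])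
  show ?thesis
    unfolding cross_mat_eq
    by (subst det_mult[OF GE])
      (auto simp: det_mult[OF _ E] det_transpose[OF diff_mat_carrier] det_diff_mat)
qed

lemma cross_mat_row:
  assumes "i \<le> s"
  shows "(\<Sum>j<Suc s. cross_mat s $$ (i,j) * f j) =
    2 * f i - (if i = 0 then 0 else f (i - 1)) - f (if i = s then s else Suc i) - [:0, 1:] * f (s - i)"
proof -
  have "(\<Sum>j<Suc s. cross_mat s $$ (i,j) * f j) =
      (\<Sum>j<Suc s. (if j = i then 2 * f j else 0)) - (\<Sum>j<Suc s. if i = Suc j then f j else 0)
      - (\<Sum>j<Suc s. if j = (if i = s then s else Suc i) then f j else 0)
      - (\<Sum>j<Suc s. if j = s - i then [:0, 1:] * f j else 0)"
    unfolding sum_subtractf[symmetric]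
    using assms by (intro sum.cong)
      (auto simp: cross_mat_def algebra_simps simp del: mult_pCons_left)
  also have "(\<Sum>j<Suc s. if i = Suc j then f j else 0) = (if i = 0 then 0 else f (i - 1))"
    using assms by (cases i) auto
  also have "(\<Sum>j<Suc s. if j = (if i = s then s else Suc i) then f j else 0) = f (if i = s then s else Suc i)"
    using assms by (subst sum.delta) auto
  finally show ?thesis using assms by (simp del: mult_pCons_left lessThan_Suc)
qed

section \<open>The zigzag order and the solutions of the kernel equations\<close>

text \<open>The order \<open>0, s, 1, s - 1, \<dots>\<close>, extended by the identity to a permutation.\<close>

definition zigzag_pos :: "nat \<Rightarrow> nat \<Rightarrow> nat" where
  "zigzag_pos s k = (if s < k then k else if even k then k div 2 else s - k div 2)"

lemma zigzag_pos_even: "2 * i \<le> s \<Longrightarrow> zigzag_pos s (2 * i) = i"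
  and zigzag_pos_odd: "Suc (2 * i) \<le> s \<Longrightarrow> zigzag_pos s (Suc (2 * i)) = s - i"
  by (simp_all add: zigzag_pos_def)

lemma zigzag_pos_le: "k \<le> s \<Longrightarrow> zigzag_pos s k \<le> s"
  using div_le_dividend[of k 2] by (auto simp: zigzag_pos_def intro: order_trans)

lemma zigzag_pos_permutes: "zigzag_pos s permutes {0..<Suc s}"
proof (rule bij_imp_permutes)
  \<comment> \<open>The inverse: an index \<open>j\<close> of the lower half stands at position
    \<open>2 * j\<close>, one of the upper half at the odd position determined by its distance
    \<open>s - j\<close> from the end.\<close>
  have inj: "inj_on (zigzag_pos s) {0..<Suc s}"
  proof (rule inj_on_inverseI[where g = "\<lambda>j. if 2 * j \<le> s then 2 * j else Suc (2 * (s - j))"])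
    fix k assume k: "k \<in> {0..<Suc s}"
    show "(if 2 * zigzag_pos s k \<le> s then 2 * zigzag_pos s k else Suc (2 * (s - zigzag_pos s k))) = k"
    proof (cases "even k")
      case True
      then obtain i where "k = 2 * i" by blast
      then show ?thesis using k by (simp add: zigzag_pos_even)
    next
      case False
      then obtain i where "k = Suc (2 * i)" using oddE by fastforce
      then show ?thesis using k by (simp add: zigzag_pos_odd)
    qed
  qed
  moreover have "zigzag_pos s ` {0..<Suc s} \<subseteq> {0..<Suc s}"
    by (intro image_subsetI) (simp add: less_Suc_eq_le zigzag_pos_le)
  ultimately show "bij_betw (zigzag_pos s) {0..<Suc s} {0..<Suc s}"
    unfolding bij_betw_def using endo_inj_surj[OF finite_atLeastLessThan] by blast
qed (simp add: zigzag_pos_def)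

text \<open>
  The two solutions of the kernel equations, with initial values \<open>(1, 0)\<close> and \<open>(0, 1)\<close> at the indices
  \<open>0\<close> and \<open>s\<close>.  In the zigzag order the first one reads \<open>a 1, b 1, a 2, b 2, \<dots>\<close>, where \<open>a\<close> and \<open>b\<close> are
  \<open>zigzag_a\<close> and \<open>zigzag_b\<close>, and the second one \<open>b 1 - b 0, a 1 - a 0, b 2 - b 1, a 2 - a 1, \<dots>\<close>
\<close>

definition sol1 :: "nat \<Rightarrow> nat \<Rightarrow> rat poly" where
  "sol1 s j = (if 2 * j \<le> s then zigzag_a (Suc j) else zigzag_b (Suc (s - j)))"

definition sol2 :: "nat \<Rightarrow> nat \<Rightarrow> rat poly" where
  "sol2 s j = (if 2 * j \<le> s then zigzag_b (Suc j) - zigzag_b j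
     else zigzag_a (Suc (s - j)) - zigzag_a (s - j))"

text \<open>
  The product of row \<open>i\<close> of \<open>cross_mat s\<close> with the vector \<open>f\<close>, see \<open>cross_mat_row\<close>.
\<close>

definition cross_app :: "nat \<Rightarrow> nat \<Rightarrow> (nat \<Rightarrow> rat poly) \<Rightarrow> rat poly" where
  "cross_app s i f = 2 * f i - (if i = 0 then 0 else f (i - 1)) - f (if i = s then s else Suc i)
     - [:0, 1:] * f (s - i)"

text \<open>For \<open>sol1\<close> the rows of the lower half are the recurrence of
  \<open>zigzag_a\<close> and those of the upper half that of \<open>zigzag_b\<close>; for
  \<open>sol2\<close> they are differences of two consecutive instances. The bound on
  \<open>k\<close> keeps the next neighbour in the same half.\<close>

lemma cross_app_sol_eq_0:
  assumes "k + 2 \<le> s"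
  shows "cross_app s (zigzag_pos s k) (sol1 s) = 0" "cross_app s (zigzag_pos s k) (sol2 s) = 0"
proof -
  have "cross_app s (zigzag_pos s k) (sol1 s) = 0 \<and> cross_app s (zigzag_pos s k) (sol2 s) = 0"
  proof (cases "even k")
    case True
    then obtain i where k: "k = 2 * i" by blast
    have s: "2 * i + 2 \<le> s" using assms k by simp
    have pos: "zigzag_pos s k = i" using s by (simp add: k zigzag_pos_even)
    have "i \<noteq> s" using s by simp
    have v1: "sol1 s i = zigzag_a (Suc i)" "(if i = 0 then 0 else sol1 s (i - 1)) = zigzag_a i"
      "sol1 s (Suc i) = zigzag_a (Suc (Suc i))" "sol1 s (s - i) = zigzag_b (Suc i)"
      using s by (auto simp: sol1_def)
    have v2: "sol2 s i = zigzag_b (Suc i) - zigzag_b i"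
      "sol2 s (Suc i) = zigzag_b (Suc (Suc i)) - zigzag_b (Suc i)"
      "sol2 s (s - i) = zigzag_a (Suc i) - zigzag_a i"
      using s by (auto simp: sol2_def)
    have "cross_app s i (sol1 s) = 0"
      unfolding cross_app_def v1 if_not_P[OF \<open>i \<noteq> s\<close>] zigzag_a.simps(3) by Groebner_Basis.algebra
    moreover have "cross_app s i (sol2 s) = 0"
    proof (cases i)
      case 0
      then show ?thesis using \<open>i \<noteq> s\<close> v2 by (simp add: cross_app_def)
    next
      case (Suc j)
      have lo: "(if i = 0 then 0 else sol2 s (i - 1)) = zigzag_b (Suc j) - zigzag_b j"
        using s by (simp add: sol2_def Suc)
      have "cross_app s i (sol2 s) = 2 * (zigzag_b (Suc i) - zigzag_b i) - (zigzag_b (Suc j) - zigzag_b j)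
          - (zigzag_b (Suc (Suc i)) - zigzag_b (Suc i)) - [:0, 1:] * (zigzag_a (Suc i) - zigzag_a i)"
        unfolding cross_app_def lo v2 if_not_P[OF \<open>i \<noteq> s\<close>] by (rule refl)
      then show ?thesis by (simp add: Suc algebra_simps del: mult_pCons_left)
    qed
    ultimately show ?thesis unfolding pos by blast
  next
    case False
    then obtain i where k: "k = Suc (2 * i)" using oddE by fastforce
    have s: "2 * i + 3 \<le> s" using assms k by simp
    have pos: "zigzag_pos s k = s - i" using s by (simp add: k zigzag_pos_odd)
    have ne: "s - i \<noteq> 0" using s by simp
    have diff: "s - (s - i - 1) = Suc i" "s - (s - i) = i" using s by auto
    have big: "\<not> 2 * (s - i) \<le> s" "\<not> 2 * (s - i - 1) \<le> s" "2 * i \<le> s" using s by auto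
    have v1: "sol1 s (s - i) = zigzag_b (Suc i)" "sol1 s (s - i - 1) = zigzag_b (Suc (Suc i))"
      "sol1 s i = zigzag_a (Suc i)"
      using diff big by (simp_all only: sol1_def if_True if_False)
    have v2: "sol2 s (s - i) = zigzag_a (Suc i) - zigzag_a i"
      "sol2 s (s - i - 1) = zigzag_a (Suc (Suc i)) - zigzag_a (Suc i)"
      "sol2 s i = zigzag_b (Suc i) - zigzag_b i"
      using diff big by (simp_all only: sol2_def if_True if_False)
    \<comment> \<open>The second value is the recurrence solved for the preceding difference. In
      this form it also covers \<open>i = 0\<close>, where the end condition repeats the value 1 at
      \<open>s\<close>.\<close>
    have upper: "sol1 s (if s - i = s then s else Suc (s - i)) = zigzag_b i"
      "sol2 s (if s - i = s then s else Suc (s - i)) =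
        2 * (zigzag_a (Suc i) - zigzag_a i) - (zigzag_a (Suc (Suc i)) - zigzag_a (Suc i))
        - [:0, 1:] * (zigzag_b (Suc i) - zigzag_b i)"
    proof -
      show "sol1 s (if s - i = s then s else Suc (s - i)) = zigzag_b i"
        using s by (cases i) (auto simp: sol1_def Suc_diff_Suc)
      show "sol2 s (if s - i = s then s else Suc (s - i)) =
        2 * (zigzag_a (Suc i) - zigzag_a i) - (zigzag_a (Suc (Suc i)) - zigzag_a (Suc i))
        - [:0, 1:] * (zigzag_b (Suc i) - zigzag_b i)"
      proof (cases i)
        case 0
        then show ?thesis using s by (auto simp: sol2_def)
      next
        case (Suc j)
        have "s - i \<noteq> s" "Suc (s - i) = s - j" "\<not> 2 * (s - j) \<le> s" "s - (s - j) = j" using s Suc by auto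
        then have e: "sol2 s (if s - i = s then s else Suc (s - i)) = zigzag_a (Suc j) - zigzag_a j"
          by (simp only: sol2_def if_False)
        show ?thesis
          unfolding e unfolding Suc zigzag_a.simps(3) zigzag_b.simps(3) by Groebner_Basis.algebra
      qed
    qed
    show ?thesis
      unfolding pos cross_app_def if_not_P[OF ne] diff v1 v2 upper zigzag_b.simps(3)
      by (simp add: algebra_simps del: mult_pCons_left)
  qed
  then show "cross_app s (zigzag_pos s k) (sol1 s) = 0" "cross_app s (zigzag_pos s k) (sol2 s) = 0"
    by auto
qed

text \<open>Multiplication by this matrix on the right is the column operation that puts the images
  of the two solutions into columns 0 and \<open>s\<close>.\<close>

definition sol_mat :: "nat \<Rightarrow> rat poly mat" where
  "sol_mat s = mat (Suc s) (Suc s)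
     (\<lambda>(i,j). if j = 0 then sol1 s i else if j = s then sol2 s i else of_bool (i = j))"

lemma sol_mat_carrier [simp]: "sol_mat s \<in> carrier_mat (Suc s) (Suc s)"
  by (simp add: sol_mat_def)

lemma cross_sol_mat_entry:
  assumes "s \<ge> 1" "i \<le> s" "j \<le> s"
  shows "(cross_mat s * sol_mat s) $$ (i,j) =
    (if j = 0 then cross_app s i (sol1 s) else if j = s then cross_app s i (sol2 s)
     else cross_mat s $$ (i,j))"
proof -
  have *: "(cross_mat s * sol_mat s) $$ (i,j) = (\<Sum>k<Suc s. cross_mat s $$ (i,k) * sol_mat s $$ (k,j))"
    using assms carrier_matD[OF cross_mat_carrier[of s]] carrier_matD[OF sol_mat_carrier[of s]]
    by (simp add: scalar_prod_def atLeast0LessThan)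
  consider "j = 0" | "j \<noteq> 0" "j = s" | "j \<noteq> 0" "j \<noteq> s" by blast
  then show ?thesis
  proof cases
    case 1
    have "(cross_mat s * sol_mat s) $$ (i,j) = (\<Sum>k<Suc s. cross_mat s $$ (i,k) * sol1 s k)"
      unfolding * using 1 by (intro sum.cong) (auto simp: sol_mat_def)
    then show ?thesis unfolding cross_mat_row[OF assms(2)] cross_app_def using 1 by simp
  next
    case 2
    have "(cross_mat s * sol_mat s) $$ (i,j) = (\<Sum>k<Suc s. cross_mat s $$ (i,k) * sol2 s k)"
      unfolding * using 2 by (intro sum.cong) (auto simp: sol_mat_def)
    then show ?thesis unfolding cross_mat_row[OF assms(2)] cross_app_def using 2 by simp
  next
    case 3
    have "(\<Sum>k<Suc s. cross_mat s $$ (i,k) * sol_mat s $$ (k,j)) =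
        (\<Sum>k<Suc s. if k = j then cross_mat s $$ (i,k) else 0)"
      using 3 assms by (intro sum.cong) (auto simp: sol_mat_def)
    then show ?thesis using 3 assms by (simp add: * del: sum.lessThan_Suc)
  qed
qed

text \<open>The matrix factors into a lower and an upper unitriangular matrix, each carrying one
  solution; \<open>sol2 s 0 = 0\<close> keeps the first from disturbing the second.\<close>

lemma det_sol_mat:
  assumes "s \<ge> 1"
  shows "det (sol_mat s) = 1"
proof -
  let ?N = "Suc s"
  define U where "U = mat ?N ?N (\<lambda>(i,j). if j = 0 then sol1 s i else of_bool (i = j))"
  define V where "V = mat ?N ?N (\<lambda>(i,j). if j = s then sol2 s i else of_bool (i = j))"
  have UV: "U \<in> carrier_mat ?N ?N" "V \<in> carrier_mat ?N ?N" by (simp_all add: U_def V_def)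
  have bd: "sol1 s 0 = 1" "sol2 s s = 1" "sol2 s 0 = 0" using assms by (auto simp: sol1_def sol2_def)
  have "sol_mat s = U * V"
  proof (rule eq_matI)
    fix i j assume "i < dim_row (U * V)" "j < dim_col (U * V)"
    then have ij: "i \<le> s" "j \<le> s" by (auto simp: U_def V_def)
    have UV_entry: "(U * V) $$ (i,j) = (\<Sum>k<?N. U $$ (i,k) * V $$ (k,j))"
      using ij UV by (simp add: scalar_prod_def atLeast0LessThan)
    also have "\<dots> = (\<Sum>k<?N. if k = i then V $$ (k,j) else 0)
        + (\<Sum>k<?N. if k = 0 then (sol1 s i - of_bool (i = 0)) * V $$ (k,j) else 0)"
      unfolding sum.distrib[symmetric] using ij by (intro sum.cong) (auto simp: U_def algebra_simps)
    also have "\<dots> = V $$ (i,j) + (sol1 s i - of_bool (i = 0)) * V $$ (0,j)"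
      using ij by (simp del: sum.lessThan_Suc)
    also have "\<dots> = sol_mat s $$ (i,j)"
      using ij assms by (auto simp: V_def sol_mat_def bd)
    finally show "sol_mat s $$ (i,j) = (U * V) $$ (i,j)" by simp
  qed (use UV in \<open>auto simp: sol_mat_def\<close>)
  moreover have "diag_mat U = replicate ?N 1" "diag_mat V = replicate ?N 1"
    using assms by (auto intro!: nth_equalityI simp: diag_mat_def U_def V_def bd simp del: upt_Suc replicate_Suc)
  moreover have "det U = prod_list (diag_mat U)"
    by (rule det_lower_triangular[of ?N]) (auto simp: U_def)
  moreover have "det V = prod_list (diag_mat V)"
    by (rule det_upper_triangular[of _ ?N]) (auto simp: V_def upper_triangular_def)
  ultimately show ?thesis by (simp add: det_mult[OF UV])
qed

section \<open>Band structure and reduction to a determinant of size 2\<close>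

text \<open>Neighbouring indices in the same half stand two positions apart, neighbours across the
  middle and an index with its reflection at most one. Hence nothing lies beyond the second
  superdiagonal.\<close>

lemma cross_mat_zigzag:
  assumes "k + 2 \<le> l" "l \<le> s"
  shows "cross_mat s $$ (zigzag_pos s k, zigzag_pos s l) = (if l = k + 2 then -1 else 0)"
proof -
  have le: "zigzag_pos s k \<le> s" "zigzag_pos s l \<le> s" using assms by (simp_all add: zigzag_pos_le)
  let ?i = "zigzag_pos s k" and ?j = "zigzag_pos s l"
  \<comment> \<open>The last conjunct excludes that both neighbour terms contribute, which would
    give the entry -2.\<close>
  have *: "?j \<noteq> ?i \<and> ?j \<noteq> s - ?i \<and>
    (?i = Suc ?j \<or> ?j = (if ?i = s then s else Suc ?i)) = (l = k + 2) \<and>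
    \<not> (?i = Suc ?j \<and> ?j = (if ?i = s then s else Suc ?i))"
  proof (cases "even k")
    case True
    then obtain i where k: "k = 2 * i" by blast
    have ki: "?i = i" using assms by (simp add: k zigzag_pos_even)
    show ?thesis
    proof (cases "even l")
      case True
      then obtain j where l: "l = 2 * j" by blast
      have lj: "?j = j" using assms by (simp add: l zigzag_pos_even)
      have "Suc i \<le> j" using assms unfolding k l by simp
      \<comment> \<open>Writing \<open>j\<close> and \<open>s\<close> as sums eliminates the
        truncated subtractions.\<close>
      then obtain d where j: "j = Suc i + d" using le_Suc_ex by blast
      obtain e where s: "s = 2 * j + e" using assms(2) le_Suc_ex unfolding l by blast
      show ?thesis unfolding ki lj unfolding k l s j by auto
    next
      case False
      then obtain j where l: "l = Suc (2 * j)" using oddE by fastforce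
      have lj: "?j = s - j" using assms by (simp add: l zigzag_pos_odd)
      have "Suc i \<le> j" using assms unfolding k l by simp
      then obtain d where j: "j = Suc i + d" using le_Suc_ex by blast
      obtain e where s: "s = Suc (2 * j) + e" using assms(2) le_Suc_ex unfolding l by blast
      show ?thesis unfolding ki lj unfolding k l s j by auto
    qed
  next
    case False
    then obtain i where k: "k = Suc (2 * i)" using oddE by fastforce
    have ki: "?i = s - i" using assms by (simp add: k zigzag_pos_odd)
    show ?thesis
    proof (cases "even l")
      case True
      then obtain j where l: "l = 2 * j" by blast
      have lj: "?j = j" using assms by (simp add: l zigzag_pos_even)
      have "Suc (Suc i) \<le> j" using assms unfolding k l by simp
      then obtain d where j: "j = Suc (Suc i) + d" using le_Suc_ex by blast
      obtain e where s: "s = 2 * j + e" using assms(2) le_Suc_ex unfolding l by blast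
      show ?thesis unfolding ki lj unfolding k l s j by auto
    next
      case False
      then obtain j where l: "l = Suc (2 * j)" using oddE by fastforce
      have lj: "?j = s - j" using assms by (simp add: l zigzag_pos_odd)
      have "Suc i \<le> j" using assms unfolding k l by simp
      then obtain d where j: "j = Suc i + d" using le_Suc_ex by blast
      obtain e where s: "s = Suc (2 * j) + e" using assms(2) le_Suc_ex unfolding l by blast
      show ?thesis unfolding ki lj unfolding k l s j by auto
    qed
  qed
  define u where "u \<longleftrightarrow> ?i = Suc ?j"
  define v where "v \<longleftrightarrow> ?j = (if ?i = s then s else Suc ?i)"
  have "cross_mat s $$ (?i, ?j) = - of_bool u - of_bool v"
    using le * unfolding u_def v_def by (simp only: cross_mat_def index_mat less_Suc_eq_le split_conv) simp
  then show ?thesis using * unfolding u_def[symmetric] v_def[symmetric] by (cases u; cases v) auto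
qed

text \<open>In zigzag order the two columns of solutions come first and vanish outside the last two
  rows. Moved to the end, they leave a lower triangular block with diagonal entries -1, the source
  of the sign.\<close>

lemma det_cross_mat_block:
  assumes "s \<ge> 1"
  defines "p \<equiv> zigzag_pos s (s - 1)" and "q \<equiv> zigzag_pos s s"
  shows "det (cross_mat s) = (-1) ^ (s - 1) *
    (cross_app s p (sol1 s) * cross_app s q (sol2 s) - cross_app s p (sol2 s) * cross_app s q (sol1 s))"
proof -
  let ?N = "Suc s" and ?m = "s - 1"
  let ?P = "zigzag_pos s"
  define B where "B = cross_mat s * sol_mat s"
  define C where "C = mat ?N ?N (\<lambda>(i,j). B $$ (?P i, ?P j))"
  define L where "L = mat ?m ?m (\<lambda>(i,j). cross_mat s $$ (?P i, ?P (j + 2)))"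
  define R where "R = mat 2 2 (\<lambda>(i,j). cross_app s (?P (?m + i)) (if j = 0 then sol1 s else sol2 s))"
  define K where "K = mat 2 ?m (\<lambda>(i,j). C $$ (i + ?m, j + 2))"
  have B: "B \<in> carrier_mat ?N ?N"
    unfolding B_def by (rule mult_carrier_mat[OF cross_mat_carrier sol_mat_carrier])
  have C: "C \<in> carrier_mat (?m + 2) (?m + 2)" using assms(1) by (simp add: C_def)
  have P01: "?P 0 = 0" "?P 1 = s" using assms(1) by (simp_all add: zigzag_pos_def)
  have C_entry: "C $$ (i,j) = (if j = 0 then cross_app s (?P i) (sol1 s)
      else if j = 1 then cross_app s (?P i) (sol2 s) else cross_mat s $$ (?P i, ?P j))"
    if "i \<le> s" "j \<le> s" for i j
  proof -
    have PP: "?P i \<le> s" "?P j \<le> s" using that by (simp_all add: zigzag_pos_le)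
    have inj: "?P j = ?P l \<longleftrightarrow> j = l" if "l \<le> s" for l
      using permutes_inj[OF zigzag_pos_permutes, of s] by (auto dest: injD)
    show ?thesis
      using that inj[of 0] inj[of 1] assms(1) P01 cross_sol_mat_entry[OF assms(1), of "?P i" "?P j"]
      by (auto simp: C_def B_def zigzag_pos_le)
  qed
  have "det (cross_mat s) = det B"
    using det_sol_mat[OF assms(1)] by (simp add: B_def det_mult[OF cross_mat_carrier sol_mat_carrier])
  also have "\<dots> = det C"
    unfolding C_def using det_permute_rows_cols[OF B zigzag_pos_permutes] by simp
  \<comment> \<open>Moving two columns past \<open>s - 1\<close> others is an even
    permutation.\<close>
  also have "\<dots> = det (mat (?m + 2) (?m + 2) (\<lambda>(i,j). C $$ (i, if j < ?m then j + 2 else j - ?m)))"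
    by (subst det_swap_cols[OF C]) simp
  also have "mat (?m + 2) (?m + 2) (\<lambda>(i,j). C $$ (i, if j < ?m then j + 2 else j - ?m)) =
      four_block_mat L (0\<^sub>m ?m 2) K R"
  proof (rule eq_matI)
    fix i j assume "i < dim_row (four_block_mat L (0\<^sub>m ?m 2) K R)"
      "j < dim_col (four_block_mat L (0\<^sub>m ?m 2) K R)"
    then have ij: "i < ?m + 2" "j < ?m + 2" by (auto simp: L_def R_def)
    show "mat (?m + 2) (?m + 2) (\<lambda>(i,j). C $$ (i, if j < ?m then j + 2 else j - ?m)) $$ (i,j) =
        four_block_mat L (0\<^sub>m ?m 2) K R $$ (i,j)"
    proof (cases "j < ?m")
      case True
      then show ?thesis using ij by (auto simp: L_def K_def R_def C_entry)
    next
      case F: False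
      then have "j - ?m = 0 \<or> j - ?m = 1" using ij by linarith
      then show ?thesis using ij F assms(1) cross_app_sol_eq_0[of i s]
        by (auto simp: L_def K_def R_def C_entry)
    qed
  qed (auto simp: L_def R_def)
  also have "det (four_block_mat L (0\<^sub>m ?m 2) K R) = det L * det R"
    by (rule det_four_block_mat_upper_right_zero[of _ ?m _ 2]) (auto simp: L_def K_def R_def)
  also have "det L = prod_list (diag_mat L)"
    by (rule det_lower_triangular[of ?m]) (auto simp: L_def cross_mat_zigzag)
  also have "diag_mat L = replicate ?m (-1)"
    by (rule nth_equalityI) (auto simp: L_def diag_mat_def cross_mat_zigzag)
  also have "det R = cross_app s p (sol1 s) * cross_app s q (sol2 s)
      - cross_app s p (sol2 s) * cross_app s q (sol1 s)"
    using assms(1) by (simp add: R_def det_mat_2 p_def q_def)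
  finally show ?thesis by simp
qed

text \<open>The last two positions belong to indices at the middle, where the neighbour of one half
  lies in the other. Evaluating the solutions there gives \<open>bdry_even\<close> for odd
  \<open>s\<close>, and \<open>bdry_odd\<close>, with the sign -1 exchanging the two products, for
  even \<open>s\<close>.\<close>

lemma det_cross_mat_eq_Q:
  assumes "s \<ge> 1"
  shows "det (cross_mat s) = Q s"
proof (cases "even s")
  case False
  then obtain m where s: "s = Suc (2 * m)" using oddE by fastforce
  have pos: "zigzag_pos s (s - 1) = m" "zigzag_pos s s = Suc m"
    using zigzag_pos_even[of m s] zigzag_pos_odd[of m s] by (simp_all add: s)
  have ne: "m \<noteq> s" "Suc m \<noteq> 0" by (simp_all add: s)
  have refl_pos: "s - m = Suc m" "s - Suc m = m" "Suc m - 1 = m" by (simp_all add: s)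
  have v: "sol1 s m = zigzag_a (Suc m)" "sol2 s m = zigzag_b (Suc m) - zigzag_b m"
    "sol1 s (Suc m) = zigzag_b (Suc m)" "sol2 s (Suc m) = zigzag_a (Suc m) - zigzag_a m"
    "(if m = 0 then 0 else sol1 s (m - 1)) = zigzag_a m"
    "(if m = 0 then 0 else sol2 s (m - 1)) = zigzag_b m - zigzag_b (m - 1)"
    "sol1 s (if Suc m = s then s else Suc (Suc m)) = zigzag_b m"
    by (cases m; simp add: sol1_def sol2_def s Suc_diff_le)+
  have w: "sol2 s (if Suc m = s then s else Suc (Suc m)) = (if m = 0 then 1 else zigzag_a m - zigzag_a (m - 1))"
    by (cases m) (simp_all add: sol2_def s Suc_diff_le)
  \<comment> \<open>The recurrence, read backwards, gives expressions that hold for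
    \<open>m = 0\<close> as well, where the end conditions apply.\<close>
  have up: "sol2 s (if Suc m = s then s else Suc (Suc m)) = zigzag_a (Suc m) - zigzag_a m + [:0, 1:] * zigzag_b m"
    unfolding w by (cases m) (simp_all del: mult_pCons_left)
  have low: "(if m = 0 then 0 else sol2 s (m - 1)) = zigzag_b (Suc m) - zigzag_b m + [:0, 1:] * zigzag_a m"
    unfolding v by (cases m) (simp_all del: mult_pCons_left)
  have rows: "cross_app s m (sol1 s) = zigzag_a (Suc (Suc m)) - zigzag_b (Suc m)"
    "cross_app s m (sol2 s) = zigzag_b (Suc (Suc m)) - zigzag_b (Suc m) - zigzag_a (Suc m) + zigzag_a m"
    "cross_app s (Suc m) (sol1 s) = zigzag_b (Suc (Suc m)) - zigzag_a (Suc m)"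
    "cross_app s (Suc m) (sol2 s) = zigzag_a (Suc (Suc m)) - zigzag_a (Suc m) - zigzag_b (Suc m) + zigzag_b m"
    unfolding cross_app_def low up if_not_P[OF ne(1)] if_not_P[OF ne(2)] refl_pos v
      zigzag_a.simps(3) zigzag_b.simps(3)
    by Groebner_Basis.algebra+
  have "det (cross_mat s) = bdry_even (Suc m)"
    unfolding det_cross_mat_block[OF assms] pos rows by (simp add: s bdry_even_def Let_def)
  then show ?thesis using Q_eq_bdry[of m] by (simp add: s)
next
  case True
  then obtain m' where "s = 2 * m'" by blast
  with assms obtain p where s: "s = 2 * Suc p" by (cases m') auto
  define m where "m = Suc p"
  have pos: "zigzag_pos s (s - 1) = Suc m" "zigzag_pos s s = m"
    using zigzag_pos_even[of m s] zigzag_pos_odd[of p s] by (simp_all add: s m_def)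
  have ne: "m \<noteq> s" "m \<noteq> 0" "Suc m \<noteq> 0" by (simp_all add: s m_def)
  \<comment> \<open>The middle index is its own reflection, so the y term in row \<open>m\<close>
    multiplies the value at \<open>m\<close> itself.\<close>
  have refl_pos: "s - m = m" "s - Suc m = p" "Suc m - 1 = m" "m - 1 = p" by (simp_all add: s m_def)
  have v: "sol1 s m = zigzag_a (Suc m)" "sol2 s m = zigzag_b (Suc m) - zigzag_b m"
    "sol1 s (Suc m) = zigzag_b m" "sol2 s (Suc m) = zigzag_a m - zigzag_a p"
    "sol1 s p = zigzag_a m" "sol2 s p = zigzag_b m - zigzag_b p"
    "sol1 s (if Suc m = s then s else Suc (Suc m)) = zigzag_b p"
    by (cases p; simp add: sol1_def sol2_def s m_def Suc_diff_le)+
  have w: "sol2 s (if Suc m = s then s else Suc (Suc m)) = (if p = 0 then 1 else zigzag_a p - zigzag_a (p - 1))"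
    by (cases p) (simp_all add: sol2_def s m_def Suc_diff_le)
  have rec: "zigzag_a (Suc m) = 2 * zigzag_a m - [:0, 1:] * zigzag_b m - zigzag_a p"
    "zigzag_b (Suc m) = 2 * zigzag_b m - [:0, 1:] * zigzag_a m - zigzag_b p"
    "zigzag_a (Suc (Suc m)) = 2 * zigzag_a (Suc m) - [:0, 1:] * zigzag_b (Suc m) - zigzag_a m"
    "zigzag_b (Suc (Suc m)) = 2 * zigzag_b (Suc m) - [:0, 1:] * zigzag_a (Suc m) - zigzag_b m"
    unfolding m_def by (rule zigzag_a.simps zigzag_b.simps)+
  have up: "sol2 s (if Suc m = s then s else Suc (Suc m)) = zigzag_a m - zigzag_a p + [:0, 1:] * zigzag_b p"
    unfolding w unfolding m_def by (cases p) (simp_all del: mult_pCons_left)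
  define y where "y = [:0, 1 :: rat:]"
  have r: "cross_app s (Suc m) (sol1 s) = zigzag_b (Suc m) - zigzag_a (Suc m)"
    "cross_app s (Suc m) (sol2 s) = zigzag_a (Suc m) - zigzag_a m - zigzag_b (Suc m) + zigzag_b m"
    "cross_app s m (sol1 s) = zigzag_a (m + 2) + zigzag_b (m + 2) + ([:0, 1:] - 2) * zigzag_b (Suc m)"
    "cross_app s m (sol2 s) = zigzag_b (m + 2) - zigzag_b (Suc m) + (zigzag_a (m + 2) - zigzag_a (Suc m))
      + ([:0, 1:] - 2) * (zigzag_a (Suc m) - zigzag_a m)"
    unfolding cross_app_def if_not_P[OF ne(1)] if_not_P[OF ne(2)] if_not_P[OF ne(3)] refl_pos v up
      add_2_eq_Suc' y_def[symmetric]
    using rec unfolding y_def[symmetric] by Groebner_Basis.algebra+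
  have "(-1 :: rat poly) ^ (s - 1) = -1" by (simp add: s)
  then have "det (cross_mat s) = bdry_odd m"
    unfolding det_cross_mat_block[OF assms] pos r bdry_odd_def Let_def by simp
  then show ?thesis using Q_eq_bdry[of m] by (simp add: s m_def)
qed

section \<open>Return to power series\<close>

lemma poly_Q_0: "poly (Q n) 0 = 1"
proof (induction n rule: Q.induct)
  case (5 n)
  then show ?case unfolding Q.simps(5) by (simp only: poly_add poly_diff poly_mult poly_minus) simp
qed simp_all

text \<open>\<open>fps_of_poly\<close> is a ring homomorphism and hence commutes with
  determinants.\<close>

lemma det_char_rev_loop_count_mat:
  assumes "s \<ge> 1"
  shows "det (char_rev_mat (loop_count_mat s)) = fps_of_poly (Q s)"
proof -
  interpret fps_of_poly: comm_ring_hom "fps_of_poly :: rat poly \<Rightarrow> rat fps"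
    by unfold_locales (simp_all add: fps_of_poly_add fps_of_poly_mult)
  have "fps_of_poly (of_nat k) = fps_const (of_nat k :: rat)" for k
    by (induction k) (simp_all add: fps_of_poly_add flip: fps_const_add)
  then have "char_rev_mat (loop_count_mat s) = map_mat fps_of_poly (char_rev_poly_mat s)"
    by (intro eq_matI)
      (auto simp: char_rev_mat_def loop_count_mat_def char_rev_poly_mat_def fps_of_poly_diff
        fps_of_poly_mult of_bool_def simp del: mult_pCons_left)
  then show ?thesis
    using det_cross_mat[of s] det_cross_mat_eq_Q[OF assms] by simp
qed

theorem theorem1p4:
  fixes s :: nat
  assumes "s \<ge> 1"
  shows "FC2 s =
    - (fps_X * fps_of_poly (pderiv (Q s)) / fps_of_poly (Q s)) + of_nat s + 1"
proof -
  define D where "D = fps_of_poly (Q s)"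
  define H where "H = Abs_fps (\<lambda>n. if n = 0 then 0 else \<Sum>i<s+1. (loop_count_mat s ^\<^sub>m n) $$ (i,i))"
  have "D $ 0 = 1" by (simp add: D_def poly_Q_0 flip: poly_0_coeff_0)
  then have "D \<noteq> 0" by auto
  have "fps_X * fps_deriv D = - D * H"
    using fps_deriv_char_rev[of "loop_count_mat s" "s + 1"] det_char_rev_loop_count_mat[OF assms]
    by (simp add: D_def H_def loop_count_mat_def del: sum.lessThan_Suc)
  then have "fps_X * fps_of_poly (pderiv (Q s)) / D = - H"
    using \<open>D \<noteq> 0\<close> by (simp add: D_def fps_of_poly_pderiv flip: mult_minus_right)
  \<comment> \<open>The trace formula holds for \<open>n > 0\<close>, so \<open>H\<close> has
    constant term 0; the convention for the empty cycle contributes \<open>s + 1\<close>.\<close>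
  moreover have "FC2 s = H + of_nat s + 1"
    by (rule fps_ext)
      (auto simp: FC2_def H_def h_C2_eq_trace h_C2_def[of 0] fps_of_nat[symmetric] simp del: sum.lessThan_Suc)
  ultimately show ?thesis by (simp add: D_def)
qed

end
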